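(* Let $\gamma>0$. For any random split $\pi$ (a permutation of $\{1,\dots,m+u\}$), and all $f\circ\phi\in\mathcal F\circ\Phi$, $$R_u(f\circ\phi;\pi)-R_{m,\gamma}(f\circ\phi;\pi)\;\le\;\frac{M(f,\phi)}{\gamma}\,\mathcal W\big(\phi_\#\mu_{\mathcal I_{\mathrm{train}}^{(\pi)}},\,\phi_\#\mu_{\mathcal I_{\mathrm{test}}^{(\pi)}}\big),$$ where $$M(f,\phi)=\max_{i,j,y}\frac{|\rho_f(\phi(\mathbf x_i),y_i)-\rho_f(\phi(\mathbf x_j),y)|}{\|\phi(\mathbf x_i)-\phi(\mathbf x_j)\|}\qquad\text{for } i\in\mathcal I_{\mathrm{train}}^{(\pi)},\; j\in\mathcal I_{\mathrm{test}}^{(\pi)},\; y\in\mathcal Y.$$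
   Context: Fixed data: positive integers $m,u$, a number of classes $K$, and a fixed (deterministic) finite dataset $(\mathbf x_i,y_i)_{i=1}^{m+u}$ with $\mathbf x_i\in\mathcal X=\mathbb R^F$ and $y_i\in\mathcal Y=\{1,\dots,K\}$. Split: a permutation $\pi$ of $\{1,\dots,m+u\}$ determines $\mathcal I_{\mathrm{train}}^{(\pi)}=\{\pi(1),\dots,\pi(m)\}$ and $\mathcal I_{\mathrm{test}}^{(\pi)}=\{\pi(m+1),\dots,\pi(m+u)\}$. Hypothesis class: $\Phi$ is a class of encoders $\phi:\mathcal X\to\mathcal Z$, where $\mathcal Z$ is the (Euclidean) embedding space with Euclidean norm $\|\cdot\|$; $\mathcal F$ is a class of score-based classifiers $f=[f_1,\dots,f_K]:\mathcal Z\to\mathbb R^K$; $\mathcal F\circ\Phi$ is the class of compositions $f\circ\phi$ with $f\in\mathcal F$, $\phi\in\Phi$. Margin: $\rho_f(z,y)=f_y(z)-\max_{y'\ne y}f_{y'}(z)$ for $z\in\mathcal Z$, $y\in\mathcal Y$. Losses: $R_u(f\circ\phi;\pi)=\frac1u\sum_{i\in\mathcal I_{\mathrm{test}}^{(\pi)}}\mathbf 1[\rho_f(\phi(\mathbf x_i),y_i)\le 0]$ and $R_{m,\gamma}(f\circ\phi;\pi)=\frac1m\sum_{i\in\mathcal I_{\mathrm{train}}^{(\pi)}}\mathbf 1[\rho_f(\phi(\mathbf x_i),y_i)\le\gamma]$. Measures: for an index set $\mathcal I$, $\mu_{\mathcal I}=\frac1{|\mathcal I|}\sum_{i\in\mathcal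 I}\delta_{\mathbf x_i}$, with $\delta_{\mathbf x}$ the Dirac measure at $\mathbf x$; $\phi_\#\mu$ is the pushforward of $\mu$ under $\phi$. $\mathcal W$ is the $1$-Wasserstein distance with Euclidean cost.
   Formalization: If a train and a test point have the same embedding, the ratio in M divides by zero; it is read as ∞ (0/0 as 0), and the case M = ∞ with Wasserstein distance 0, where the right side is ∞·0, is excluded. K ≥ 2 is assumed so that the margin is defined. *)

theory Defs
  imports "HOL-Probability.Probability" "HOL-Combinatorics.Permutations"
begin

text \<open>
  The label set \<open>{1, \<dots>, K}\<close> is a finite type \<open>'k\<close> with \<open>K = CARD('k)\<close>, so that a score-based
  classifier is a map into \<open>real ^ 'k\<close>. The sample is indexed by \<open>{1..m+u}\<close>; values of
  \<open>x\<close> and \<open>y\<close> at other indices are irrelevant.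
\<close>

definition train_idx :: "nat \<Rightarrow> (nat \<Rightarrow> nat) \<Rightarrow> nat set" where
  "train_idx m \<pi> = \<pi> ` {1..m}"

definition test_idx :: "nat \<Rightarrow> nat \<Rightarrow> (nat \<Rightarrow> nat) \<Rightarrow> nat set" where
  "test_idx m u \<pi> = \<pi> ` {m+1..m+u}"

text \<open>The maximum is over a nonempty set only if there are at least two classes.\<close>

definition margin :: "('z \<Rightarrow> real ^ 'k) \<Rightarrow> 'z \<Rightarrow> 'k \<Rightarrow> real" where
  "margin f z y = f z $ y - Max ((\<lambda>y'. f z $ y') ` {y'. y' \<noteq> y})"

definition test_risk ::
  "nat \<Rightarrow> nat \<Rightarrow> (nat \<Rightarrow> 'x) \<Rightarrow> (nat \<Rightarrow> 'k) \<Rightarrow> (nat \<Rightarrow> nat) \<Rightarrow> ('z \<Rightarrow> real ^ 'k) \<Rightarrow> ('x \<Rightarrow> 'z) \<Rightarrow> real" where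
  "test_risk m u x y \<pi> f \<phi> =
     1 / real u * (\<Sum>i\<in>test_idx m u \<pi>. of_bool (margin f (\<phi> (x i)) (y i) \<le> 0))"

definition train_margin_risk ::
  "nat \<Rightarrow> real \<Rightarrow> (nat \<Rightarrow> 'x) \<Rightarrow> (nat \<Rightarrow> 'k) \<Rightarrow> (nat \<Rightarrow> nat) \<Rightarrow> ('z \<Rightarrow> real ^ 'k) \<Rightarrow> ('x \<Rightarrow> 'z) \<Rightarrow> real" where
  "train_margin_risk m \<gamma> x y \<pi> f \<phi> =
     1 / real m * (\<Sum>i\<in>train_idx m \<pi>. of_bool (margin f (\<phi> (x i)) (y i) \<le> \<gamma>))"

text \<open>
  The measure \<open>1/|I| * (\<Sum>i\<in>I. \<delta>\<^sub>x\<^sub>i)\<close>. It is taken on the full power set, where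
  Dirac measures are defined anyway; thus every encoder is measurable and its pushforward to the
  Borel sets makes sense without any regularity assumption. For a Borel encoder the pushforward is
  the same as that of the restriction of this measure to the Borel sets.
\<close>

definition empirical_measure :: "(nat \<Rightarrow> 'x) \<Rightarrow> nat set \<Rightarrow> 'x measure" where
  "empirical_measure x I = measure_of UNIV UNIV
     (\<lambda>A. ennreal (1 / real (card I)) * (\<Sum>i\<in>I. emeasure (return (count_space UNIV) (x i)) A))"

lemma space_empirical_measure [simp]: "space (empirical_measure x I) = UNIV"
  by (simp add: empirical_measure_def)

lemma sets_empirical_measure [simp]: "sets (empirical_measure x I) = UNIV"
  unfolding empirical_measure_def
  by (metis Pow_UNIV sets_measure_of sigma_algebra.sigma_sets_eq sigma_algebra_Pow subset_refl)

lemma emeasure_empirical_measure: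
  "emeasure (empirical_measure x I) A =
     ennreal (1 / real (card I)) * (\<Sum>i\<in>I. emeasure (return (count_space UNIV) (x i)) A)"
  (is "_ = ?\<mu> A")
proof -
  have "countably_additive UNIV ?\<mu>"
  proof (rule countably_additiveI)
    fix B :: "nat \<Rightarrow> 'a set"
    assume "disjoint_family B"
    then have "(\<Sum>n. emeasure (return (count_space UNIV) (x i)) (B n)) =
        emeasure (return (count_space UNIV) (x i)) (\<Union>n. B n)" for i
      by (intro suminf_emeasure) auto
    then show "(\<Sum>n. ?\<mu> (B n)) = ?\<mu> (\<Union>n. B n)"
      by (simp add: suminf_sum)
  qed
  then show ?thesis
    by (intro emeasure_measure_of[OF empirical_measure_def]) (auto simp: positive_def)
qed

definition couplings :: "'z measure \<Rightarrow> 'z measure \<Rightarrow> ('z \<times> 'z) measure set" where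
  "couplings \<mu> \<nu> = {C. sets C = sets (\<mu> \<Otimes>\<^sub>M \<nu>) \<and> distr C \<mu> fst = \<mu> \<and> distr C \<nu> snd = \<nu>}"

definition wasserstein1 :: "'z::euclidean_space measure \<Rightarrow> 'z measure \<Rightarrow> ennreal" where
  "wasserstein1 \<mu> \<nu> = (INF C\<in>couplings \<mu> \<nu>. \<integral>\<^sup>+p. ennreal (norm (fst p - snd p)) \<partial>C)"

text \<open>
  The maximum is taken in \<open>ennreal\<close> because distinct sample points may have the same
  embedding: there \<open>a / 0 = \<infinity>\<close> for \<open>a > 0\<close> and \<open>0 / 0 = 0\<close>. (In \<open>real\<close> one would have
  \<open>a / 0 = 0\<close>, and the maximum would not see such pairs.)
  Note that \<open>\<infinity> * 0 = 0\<close> in \<open>ennreal\<close>; a product \<open>M * W\<close> with \<open>M = \<infinity>\<close> and \<open>W = 0\<close> carries no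
  information and has to be excluded where it occurs.
\<close>

definition margin_lipschitz ::
  "nat \<Rightarrow> nat \<Rightarrow> (nat \<Rightarrow> 'x) \<Rightarrow> (nat \<Rightarrow> 'k) \<Rightarrow> (nat \<Rightarrow> nat) \<Rightarrow>
     ('z::euclidean_space \<Rightarrow> real ^ 'k) \<Rightarrow> ('x \<Rightarrow> 'z) \<Rightarrow> ennreal" where
  "margin_lipschitz m u x y \<pi> f \<phi> =
     Max ((\<lambda>(i, j, l). ennreal \<bar>margin f (\<phi> (x i)) (y i) - margin f (\<phi> (x j)) l\<bar> /
                       ennreal (norm (\<phi> (x i) - \<phi> (x j))))
          ` (train_idx m \<pi> \<times> test_idx m u \<pi> \<times> UNIV))"

end

theory Submission imports Defs begin

text \<open>
  Let \<open>A\<close> be the set of embedded training points with margin above \<open>\<gamma>\<close> and \<open>B\<close> the set of embedded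
  test points with nonpositive margin. Under any coupling \<open>C\<close> of the two embedded samples,
  \<open>C (A \<times> B)\<close> is at least \<open>\<mu> A + \<nu> B - 1\<close>, hence at least the difference of the risks. By the
  definition of \<open>M\<close> the points of \<open>A\<close> and \<open>B\<close> have distance at least \<open>\<gamma> / M\<close>, so by Markov's
  inequality the transport cost of \<open>C\<close> is at least \<open>\<gamma> / M\<close> times the difference of the risks.
\<close>

lemma emeasure_empirical_measure_card:
  assumes "finite I"
  shows "emeasure (empirical_measure x I) A = ennreal (real (card {i\<in>I. x i \<in> A}) / real (card I))"
proof -
  have "(\<Sum>i\<in>I. emeasure (return (count_space UNIV) (x i)) A) = (\<Sum>i\<in>I. indicator A (x i))"
    by simp
  also have "\<dots> = of_nat (card {i\<in>I. x i \<in> A})"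
    using assms by (simp add: indicator_def sum.If_cases Int_def)
  also have "\<dots> = ennreal (real (card {i\<in>I. x i \<in> A}))"
    by (simp add: ennreal_of_nat_eq_real_of_nat)
  finally show ?thesis
    by (simp add: emeasure_empirical_measure flip: ennreal_mult)
qed

lemma prob_space_empirical_measure:
  assumes "finite I" "I \<noteq> {}"
  shows "prob_space (empirical_measure x I)"
  by (rule prob_spaceI) (use assms in \<open>simp add: emeasure_empirical_measure_card\<close>)

text \<open>On the power set every preimage is measurable, so only the range condition remains. This
  allows an arbitrary encoder to be pushed forward to the Borel sets.\<close>

lemma measurable_empirical_measure: "\<phi> \<in> empirical_measure x I \<rightarrow>\<^sub>M N \<longleftrightarrow> range \<phi> \<subseteq> space N"
  by (auto simp: measurable_def)

lemma measure_distr_empirical_measure: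
  assumes "finite I" "A \<in> sets borel"
  shows "measure (distr (empirical_measure x I) borel \<phi>) A =
    real (card {i\<in>I. \<phi> (x i) \<in> A}) / real (card I)"
  using assms
  by (simp add: measure_def emeasure_distr measurable_empirical_measure
      emeasure_empirical_measure_card)

text \<open>Any coupling must send mass at least
  \<open>measure \<mu> A + measure \<nu> B - 1\<close> from \<open>A\<close> to \<open>B\<close>,
  and each unit of it costs at least \<open>\<delta>\<close>. If \<open>\<delta>\<close> or this
  mass bound is negative, \<open>ennreal\<close> truncates it to 0 and the claim is trivial.\<close>

lemma wasserstein1_ge_separated:
  fixes \<mu> \<nu> :: "'z::euclidean_space measure"
  assumes "prob_space \<mu>" "prob_space \<nu>" "sets \<mu> = sets borel" "sets \<nu> = sets borel"
    and A: "A \<in> sets borel" and B: "B \<in> sets borel"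
    and sep: "\<And>a b. a \<in> A \<Longrightarrow> b \<in> B \<Longrightarrow> \<delta> \<le> norm (a - b)"
  shows "ennreal \<delta> * ennreal (measure \<mu> A + measure \<nu> B - 1) \<le> wasserstein1 \<mu> \<nu>"
  unfolding wasserstein1_def
proof (rule INF_greatest)
  fix C assume "C \<in> couplings \<mu> \<nu>"
  then have sets_C: "sets C = sets (\<mu> \<Otimes>\<^sub>M \<nu>)" and fst_C: "distr C \<mu> fst = \<mu>"
    and snd_C: "distr C \<nu> snd = \<nu>"
    by (auto simp: couplings_def)
  have sets_C' [measurable_cong]: "sets C = sets (borel \<Otimes>\<^sub>M borel)"
    using sets_C assms(3,4) by (simp cong: sets_pair_measure_cong)
  have space_C: "space C = UNIV"
    using sets_eq_imp_space_eq[OF sets_C'] by (simp add: space_pair_measure)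
  have fst_m: "fst \<in> C \<rightarrow>\<^sub>M \<mu>" and snd_m: "snd \<in> C \<rightarrow>\<^sub>M \<nu>"
    using sets_C by (auto cong: measurable_cong_sets)
  interpret C: prob_space C
    using assms(1) fst_C fst_m prob_space_distrD by metis
  have mA: "measure \<mu> A = measure C (fst -` A)"
    using measure_distr[OF fst_m, of A] A assms(3) by (simp add: fst_C space_C)
  have mB: "measure \<nu> B = measure C (snd -` B)"
    using measure_distr[OF snd_m, of B] B assms(4) by (simp add: snd_C space_C)
  have sA: "fst -` A \<in> sets C"
    using measurable_sets[OF fst_m, of A] A assms(3) by (simp add: space_C)
  have sB: "snd -` B \<in> sets C"
    using measurable_sets[OF snd_m, of B] B assms(4) by (simp add: space_C)
  have AB: "A \<times> B = fst -` A \<inter> snd -` B"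
    by auto
  \<comment> \<open>Inclusion-exclusion for the two marginal events, whose union has probability at
    most 1.\<close>
  have "measure \<mu> A + measure \<nu> B - 1 \<le> measure C (A \<times> B)"
    using C.prob_le_1[of "fst -` A \<union> snd -` B"]
      measure_Un3[of "fst -` A" C "snd -` B"] sA sB
    by (simp add: mA mB AB C.fmeasurable_eq_sets)
  then have "ennreal \<delta> * ennreal (measure \<mu> A + measure \<nu> B - 1) \<le> ennreal \<delta> * emeasure C (A \<times> B)"
    by (intro mult_left_mono) (auto simp: C.emeasure_eq_measure intro: ennreal_leI)
  also have "\<dots> = (\<integral>\<^sup>+p. ennreal \<delta> * indicator (A \<times> B) p \<partial>C)"
    using sA sB by (subst nn_integral_cmult_indicator) (auto simp: AB)
  \<comment> \<open>Markov's inequality done pointwise: on \<open>A \<times> B\<close> the cost is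
    at least \<open>\<delta>\<close> by \<open>sep\<close>, elsewhere the left integrand
    vanishes.\<close>
  also have "\<dots> \<le> (\<integral>\<^sup>+p. ennreal (norm (fst p - snd p)) \<partial>C)"
    by (intro nn_integral_mono) (auto simp: indicator_def sep intro!: ennreal_leI)
  finally show "ennreal \<delta> * ennreal (measure \<mu> A + measure \<nu> B - 1)
      \<le> (\<integral>\<^sup>+p. ennreal (norm (fst p - snd p)) \<partial>C)" .
qed

text \<open>A finite maximum of the quotients is a Lipschitz bound without division, valid even for
  train and test points with the same embedding.\<close>

lemma margin_diff_le_margin_lipschitz:
  fixes y :: "nat \<Rightarrow> 'k::finite" and \<phi> :: "'x \<Rightarrow> 'z::euclidean_space"
  assumes fin: "margin_lipschitz m u x y \<pi> f \<phi> = ennreal L" "L \<ge> 0"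
    and ij: "i \<in> train_idx m \<pi>" "j \<in> test_idx m u \<pi>"
  shows "\<bar>margin f (\<phi> (x i)) (y i) - margin f (\<phi> (x j)) l\<bar> \<le> L * norm (\<phi> (x i) - \<phi> (x j))"
    (is "?d \<le> L * ?n")
proof -
  have "ennreal ?d / ennreal ?n \<le> margin_lipschitz m u x y \<pi> f \<phi>"
    unfolding margin_lipschitz_def
    by (rule Max_ge) (use ij in \<open>force simp: train_idx_def test_idx_def\<close>)+
  then have le: "ennreal ?d / ennreal ?n \<le> ennreal L"
    by (simp add: fin)
  show ?thesis
  proof (cases "?n = 0")
    \<comment> \<open>A positive difference over distance 0 would be infinite in
      \<open>ennreal\<close>, contradicting the bound \<open>L\<close>; hence the margins
      agree.\<close>
    case True
    with le have "?d = 0"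
      by (cases "?d = 0") (auto simp: top_unique)
    with fin(2) show ?thesis by simp
  next
    case False
    then have "ennreal (?d / ?n) \<le> ennreal L"
      using le by (simp add: divide_ennreal)
    with False fin(2) show ?thesis
      by (simp add: field_simps)
  qed
qed

theorem theorem4p1:
  fixes m u :: nat and \<gamma> :: real
    and x :: "nat \<Rightarrow> real ^ 'n" and y :: "nat \<Rightarrow> 'k::finite"
    and \<F> :: "('z::euclidean_space \<Rightarrow> real ^ 'k) set"
    and \<Phi> :: "(real ^ 'n \<Rightarrow> 'z) set"
    and f :: "'z \<Rightarrow> real ^ 'k" and \<phi> :: "real ^ 'n \<Rightarrow> 'z"
    and \<pi> :: "nat \<Rightarrow> nat"
  defines "M \<equiv> margin_lipschitz m u x y \<pi> f \<phi>"
    and "W \<equiv> wasserstein1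
           (distr (empirical_measure x (train_idx m \<pi>)) borel \<phi>)
           (distr (empirical_measure x (test_idx m u \<pi>)) borel \<phi>)"
  assumes "m \<ge> 1" and "u \<ge> 1" and "CARD('k) \<ge> 2" and "\<gamma> > 0"
    and "\<pi> permutes {1..m+u}"
    and "f \<in> \<F>" and "\<phi> \<in> \<Phi>"
    and "\<not> (M = \<infinity> \<and> W = 0)"
  shows "ereal (test_risk m u x y \<pi> f \<phi> - train_margin_risk m \<gamma> x y \<pi> f \<phi>)
           \<le> enn2ereal (M / ennreal \<gamma> * W)"
proof -
  define I where "I = train_idx m \<pi>"
  define J where "J = test_idx m u \<pi>"
  define \<mu> where "\<mu> = distr (empirical_measure x I) borel \<phi>"
  define \<nu> where "\<nu> = distr (empirical_measure x J) borel \<phi>"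
  define I' where "I' = {i\<in>I. margin f (\<phi> (x i)) (y i) > \<gamma>}"
  define J' where "J' = {j\<in>J. margin f (\<phi> (x j)) (y j) \<le> 0}"
  define A where "A = (\<lambda>i. \<phi> (x i)) ` I'"
  define B where "B = (\<lambda>j. \<phi> (x j)) ` J'"
  define D where "D = test_risk m u x y \<pi> f \<phi> - train_margin_risk m \<gamma> x y \<pi> f \<phi>"
  have "inj \<pi>"
    using assms(7) permutes_inj by auto
  then have cards: "card I = m" "card J = u"
    by (auto simp: I_def J_def train_idx_def test_idx_def card_image inj_on_subset)
  then have ne: "I \<noteq> {}" "J \<noteq> {}"
    using assms(3,4) by auto
  have fin: "finite I" "finite J"
    by (auto simp: I_def J_def train_idx_def test_idx_def)
  have [measurable]: "A \<in> sets borel" "B \<in> sets borel"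
    using fin by (auto simp: A_def B_def I'_def J'_def intro!: borel_closed finite_imp_closed)
  have train: "train_margin_risk m \<gamma> x y \<pi> f \<phi> = 1 - real (card I') / real m"
  proof -
    have "I = I' \<union> {i\<in>I. margin f (\<phi> (x i)) (y i) \<le> \<gamma>}"
      by (auto simp: I'_def)
    then have "m = card (I' \<union> {i\<in>I. margin f (\<phi> (x i)) (y i) \<le> \<gamma>})"
      using cards by simp
    also have "\<dots> = card I' + card {i\<in>I. margin f (\<phi> (x i)) (y i) \<le> \<gamma>}"
      using fin by (intro card_Un_disjoint) (auto simp: I'_def)
    finally have "real m = real (card I') + real (card {i\<in>I. margin f (\<phi> (x i)) (y i) \<le> \<gamma>})"
      by simp
    then show ?thesis
      using fin assms(3) by (simp add: train_margin_risk_def Int_def field_simps flip: I_def)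
  qed
  have test: "test_risk m u x y \<pi> f \<phi> = real (card J') / real u"
    using fin by (simp add: test_risk_def J'_def Int_def flip: J_def)
  \<comment> \<open>Only inequalities: a point outside \<open>I'\<close> may share its embedding
    with a point of \<open>I'\<close> and yet have a smaller margin because of its label. The same
    can happen for \<open>J'\<close>.\<close>
  have "card I' \<le> card {i\<in>I. \<phi> (x i) \<in> A}" "card J' \<le> card {j\<in>J. \<phi> (x j) \<in> B}"
    using fin by (auto simp: A_def B_def I'_def J'_def intro!: card_mono)
  then have "real (card I') / real m \<le> measure \<mu> A" "real (card J') / real u \<le> measure \<nu> B"
    by (auto simp: \<mu>_def \<nu>_def measure_distr_empirical_measure fin cards divide_right_mono)
  then have D_le: "D \<le> measure \<mu> A + measure \<nu> B - 1"
    by (simp add: D_def train test)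
  have W: "W = wasserstein1 \<mu> \<nu>"
    by (simp add: W_def \<mu>_def \<nu>_def I_def J_def)
  show ?thesis
  proof (cases "D \<le> 0")
    case True
    then have "ereal D \<le> 0"
      by simp
    also have "0 \<le> enn2ereal (M / ennreal \<gamma> * W)"
      by (rule enn2ereal_nonneg)
    finally show ?thesis
      by (simp only: D_def)
  next
    case D_pos: False
    show ?thesis
    proof (cases "M = \<infinity>")
      case True
      \<comment> \<open>Here the excluded case \<open>\<infinity> * 0\<close> matters:
        \<open>W\<close> is nonzero, so the right-hand side is infinite.\<close>
      with assms(6,10) have "M / ennreal \<gamma> * W = \<infinity>"
        by (simp add: ennreal_top_divide ennreal_top_mult)
      then show ?thesis
        by simp
    next
      case False
      then obtain L where L: "M = ennreal L" "L \<ge> 0"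
        by (cases M) auto
      \<comment> \<open>The margin is above \<open>\<gamma>\<close> at the training point and at
        most 0 at the test point, each with its own label. The maximum ranges over all labels at the
        test point, so it covers \<open>y j\<close>.\<close>
      have gap: "\<gamma> \<le> L * norm (a - b)" if "a \<in> A" "b \<in> B" for a b
      proof -
        from that obtain i j where ij: "i \<in> I'" "j \<in> J'" "a = \<phi> (x i)" "b = \<phi> (x j)"
          by (auto simp: A_def B_def)
        then have "\<bar>margin f a (y i) - margin f b (y j)\<bar> \<le> L * norm (a - b)"
          using margin_diff_le_margin_lipschitz[OF L(1)[unfolded M_def] L(2)]
          by (simp add: I'_def J'_def I_def J_def)
        then show ?thesis
          using ij by (auto simp: I'_def J'_def)
      qed
      \<comment> \<open>\<open>D\<close> is the sum of the two fractions minus 1 and each fraction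
        is at most 1. So \<open>D > 0\<close> makes both sets nonempty, and \<open>gap\<close> at
        one pair then rules out \<open>L = 0\<close>.\<close>
      have "card I' \<le> m" "card J' \<le> u"
        unfolding cards[symmetric] using fin by (auto simp: I'_def J'_def intro!: card_mono)
      then have "real (card I') / real m \<le> 1" "real (card J') / real u \<le> 1"
        by (auto simp: divide_le_eq_1)
      then have "I' \<noteq> {}" "J' \<noteq> {}"
        using D_pos by (auto simp: D_def train test)
      then obtain a b where "a \<in> A" "b \<in> B"
        by (auto simp: A_def B_def)
      then have "L \<noteq> 0"
        using gap assms(6) by fastforce
      with L have "L > 0"
        by simp
      have "ennreal (\<gamma> / L) * ennreal D
          \<le> ennreal (\<gamma> / L) * ennreal (measure \<mu> A + measure \<nu> B - 1)"
        using D_le by (intro mult_left_mono ennreal_leI) auto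
      also have "\<dots> \<le> W"
        unfolding W
      proof (rule wasserstein1_ge_separated)
        show "prob_space \<mu>" "prob_space \<nu>"
          by (auto simp: \<mu>_def \<nu>_def measurable_empirical_measure
              intro!: prob_space.prob_space_distr prob_space_empirical_measure fin ne)
        show "\<gamma> / L \<le> norm (a - b)" if "a \<in> A" "b \<in> B" for a b
          using gap[OF that] \<open>L > 0\<close> by (simp add: field_simps)
      qed (auto simp: \<mu>_def \<nu>_def)
      finally have "M / ennreal \<gamma> * (ennreal (\<gamma> / L) * ennreal D) \<le> M / ennreal \<gamma> * W"
        by (rule mult_left_mono) simp
      \<comment> \<open>The factors \<open>L / \<gamma>\<close> and \<open>\<gamma> / L\<close>
        cancel, both being finite and positive.\<close>
      moreover have "M / ennreal \<gamma> * (ennreal (\<gamma> / L) * ennreal D) = ennreal D"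
        using \<open>L > 0\<close> assms(6) D_pos
        by (simp add: L divide_ennreal flip: ennreal_mult)
      ultimately have "ennreal D \<le> M / ennreal \<gamma> * W"
        by simp
      then have "enn2ereal (ennreal D) \<le> enn2ereal (M / ennreal \<gamma> * W)"
        by (simp add: less_eq_ennreal.rep_eq)
      with D_pos show ?thesis
        by (simp add: D_def)
    qed
  qed
qed

end
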